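(* Let $\mathtt r\le \mathtt r_0$ and suppose that the following two conditions hold for this $\mathtt r$. (i) There is a constant $\omega(\mathtt r)\in[0,1/2]$ such that for all $\theta\in\Theta_0(\mathtt r)$ and all $|\lambda|\le \mathtt g$, $$\sup_{\gamma\in\mathbb R^p\setminus\{0\}}\log \mathbb E\exp\Big\{\lambda\,\frac{\gamma^\top\{\nabla\zeta(\theta)-\nabla\zeta(\theta^* )\}}{\omega(\mathtt r)\,\|V_0\gamma\|}\Big\}\le \frac{\nu_0^2\lambda^2}{2}.$$ (ii) There are a symmetric strictly positive-definite matrix $D_0^2$ and a constant $\delta(\mathtt r)\in[0,1/2]$ such that for all $\theta\in\Theta_0(\mathtt r)$, $\theta\neq\theta^*$, $$\Big|\frac{-2\,\mathbb E L(\theta,\theta^* )}{\|D_0(\theta-\theta^* )\|^2}-1\Big|\le\delta(\mathtt r).$$ Let $\varrho\ge 3\nu_0\,\omega(\mathtt r)$ and $\delta\ge\delta(\mathtt r)$ be such that $D_\epsilon^2=D_0^2(1-\delta)-\varrho V_0^2$ is positive definite, $\epsilon=(\delta,\varrho)$, $\underline\epsilon=-\epsilon$. Then on the random set $$C_\epsilon(\mathtt r)=\{\tilde\theta\in\Theta_0(\mathtt r),\ \|V_0D_{\underline\epsilon}^{-1}\xi_{\underline\epsilon}\|\le\mathtt r\}$$ it holds $$\|\xi_{\underline\epsilon}\|^2/2-\Diamond_{\underline\epsilon}(\mathtt r)\ \le\ L(\tilde\theta,\theta^* )\ \le\ \|\xi_\epsilon\|^2/2+\Diamond_\epsilon(\mathtt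 r).$$
   Context: Setting. $\Theta\subseteq\mathbb R^p$. The data $Y$ have a distribution $\mathbb P$ with expectation $\mathbb E$. $L(\theta)=L(Y,\theta)$, $\theta\in\Theta$, is a random function (a quasi log-likelihood; $\mathbb P$ need not belong to any parametric family). Put $L(\theta,\theta')=L(\theta)-L(\theta')$. The quasi maximum likelihood estimator $\tilde\theta=\arg\max_{\theta\in\Theta}L(\theta)$ is assumed to exist (the maximum is attained; if not unique, $\tilde\theta$ is any maximizer). The target is $\theta^*=\arg\max_{\theta\in\Theta}\mathbb E L(\theta)$, and $\nabla\mathbb E L(\theta^* )=0$. The stochastic component $\zeta(\theta)=L(\theta)-\mathbb E L(\theta)$ is differentiable in $\theta$; thus $\nabla L(\theta^* )=\nabla\zeta(\theta^* )$. $V_0^2$ is a symmetric positive-definite $p\times p$ matrix (with symmetric root $V_0$), $\mathtt g>0$, $\nu_0\ge1$ and $\mathtt r_0>0$ are constants. The local set is $\Theta_0(\mathtt r)=\{\theta:\|V_0(\theta-\theta^* )\|\le \mathtt r\}$, a full ellipsoid contained in $\Theta$ for $\mathtt r\le\mathtt r_0$. When $\omega(\mathtt r)=0$, condition (i) means $\nabla\zeta(\theta)=\nabla\zeta(\theta^* )$ on $\Theta_0(\mathtt r)$. $D_{\underline\epsilon}^2=D_0^2(1+\delta)+\varrho V_0^2$; $\xi_\epsilon=D_\epsilon^{-1}\nabla L(\theta^* )$, $\xi_{\underline\epsilon}=D_{\underline\epsilon}^{-1}\nabla L(\theta^* )$ (symmetric positive-definite roots). With $\zeta(\theta,\theta^*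 )=\zeta(\theta)-\zeta(\theta^* )$, $$\Diamond_{\epsilon}(\mathtt r)=\sup_{\theta\in\Theta_0(\mathtt r)}\Big\{\zeta(\theta,\theta^* )-(\theta-\theta^* )^\top\nabla\zeta(\theta^* )-\tfrac{\varrho}{2}\|V_0(\theta-\theta^* )\|^2\Big\},$$ $$\Diamond_{\underline\epsilon}(\mathtt r)=\sup_{\theta\in\Theta_0(\mathtt r)}\Big\{-\zeta(\theta,\theta^* )+(\theta-\theta^* )^\top\nabla\zeta(\theta^* )-\tfrac{\varrho}{2}\|V_0(\theta-\theta^* )\|^2\Big\}.$$ *)

theory Defs
  imports "HOL-Probability.Probability"
begin

definition sym_pos_def :: "real^'n^'n \<Rightarrow> bool" where
  "sym_pos_def A \<longleftrightarrow> transpose A = A \<and> (\<forall>x. x \<noteq> 0 \<longrightarrow> x \<bullet> (A *v x) > 0)"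

text \<open>A symmetric positive-definite matrix has exactly one symmetric positive-definite root,
  so the choice below is canonical. On other matrices the value is unspecified.\<close>

definition mat_root :: "real^'n^'n \<Rightarrow> real^'n^'n" where
  "mat_root A = (SOME B. sym_pos_def B \<and> B ** B = A)"

text \<open>The gradient is taken within the parameter set, because the functions of interest have
  meaningful values only there. At interior points, and at every point of a full ellipsoid
  contained in the set, it is unique and is the usual gradient. The value is meaningful only where
  the function is differentiable.\<close>

definition grad_within :: "(real^'n) set \<Rightarrow> (real^'n \<Rightarrow> real) \<Rightarrow> real^'n \<Rightarrow> real^'n" where
  "grad_within S f x = (SOME g. (f has_derivative (\<lambda>h. g \<bullet> h)) (at x within S))"

text \<open>Logarithm of the exponential moment of \<open>X\<close>, with the value \<open>\<infinity>\<close> if that moment is not finite.\<close>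

definition log_exp_moment :: "'y measure \<Rightarrow> ('y \<Rightarrow> real) \<Rightarrow> ereal" where
  "log_exp_moment P X =
     (if integrable P (\<lambda>y. exp (X y)) then ereal (ln (\<integral>y. exp (X y) \<partial>P)) else \<infinity>)"

text \<open>In what follows \<open>P\<close> is the distribution of the data, \<open>L y \<theta>\<close> is the quasi log-likelihood at the
  parameter \<open>\<theta>\<close> for the data \<open>y\<close>, and matrices such as \<open>V\<^sub>0\<^sup>2\<close> are given as \<open>V2\<close>.\<close>

definition mean_fun :: "'y measure \<Rightarrow> ('y \<Rightarrow> real^'n \<Rightarrow> real) \<Rightarrow> real^'n \<Rightarrow> real" where
  "mean_fun P L \<theta> = (\<integral>y. L y \<theta> \<partial>P)"

definition stoch_comp :: "'y measure \<Rightarrow> ('y \<Rightarrow> real^'n \<Rightarrow> real) \<Rightarrow> 'y \<Rightarrow> real^'n \<Rightarrow> real" where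
  "stoch_comp P L y \<theta> = L y \<theta> - mean_fun P L \<theta>"

definition local_set :: "real^'n^'n \<Rightarrow> real^'n \<Rightarrow> real \<Rightarrow> (real^'n) set" where
  "local_set V2 \<theta>s r = {\<theta>. norm (mat_root V2 *v (\<theta> - \<theta>s)) \<le> r}"

text \<open>\<open>D\<^sub>\<epsilon>\<^sup>2\<close> for \<open>\<epsilon> = (\<delta>, \<rho>)\<close>; the version for \<open>-\<epsilon>\<close> is obtained at \<open>(-\<delta>, -\<rho>)\<close>.\<close>

definition D_eps_sq :: "real^'n^'n \<Rightarrow> real^'n^'n \<Rightarrow> real \<Rightarrow> real \<Rightarrow> real^'n^'n" where
  "D_eps_sq D2 V2 \<delta> \<rho> = (1 - \<delta>) *\<^sub>R D2 - \<rho> *\<^sub>R V2"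

definition D_eps_inv :: "real^'n^'n \<Rightarrow> real^'n^'n \<Rightarrow> real \<Rightarrow> real \<Rightarrow> real^'n^'n" where
  "D_eps_inv D2 V2 \<delta> \<rho> = matrix_inv (mat_root (D_eps_sq D2 V2 \<delta> \<rho>))"

definition xi_eps ::
  "(real^'n) set \<Rightarrow> ('y \<Rightarrow> real^'n \<Rightarrow> real) \<Rightarrow> real^'n \<Rightarrow> real^'n^'n \<Rightarrow> real^'n^'n
    \<Rightarrow> real \<Rightarrow> real \<Rightarrow> 'y \<Rightarrow> real^'n" where
  "xi_eps \<Theta> L \<theta>s D2 V2 \<delta> \<rho> y = D_eps_inv D2 V2 \<delta> \<rho> *v grad_within \<Theta> (L y) \<theta>s"

text \<open>The two error terms, as functions of a realization \<open>z\<close> of the stochastic component.\<close>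

definition diamond_upper ::
  "(real^'n) set \<Rightarrow> real^'n^'n \<Rightarrow> real^'n \<Rightarrow> real \<Rightarrow> real \<Rightarrow> (real^'n \<Rightarrow> real) \<Rightarrow> real" where
  "diamond_upper \<Theta> V2 \<theta>s \<rho> r z =
     (SUP \<theta>\<in>local_set V2 \<theta>s r.
        (z \<theta> - z \<theta>s) - (\<theta> - \<theta>s) \<bullet> grad_within \<Theta> z \<theta>s
          - \<rho> / 2 * (norm (mat_root V2 *v (\<theta> - \<theta>s)))\<^sup>2)"

definition diamond_lower ::
  "(real^'n) set \<Rightarrow> real^'n^'n \<Rightarrow> real^'n \<Rightarrow> real \<Rightarrow> real \<Rightarrow> (real^'n \<Rightarrow> real) \<Rightarrow> real" where
  "diamond_lower \<Theta> V2 \<theta>s \<rho> r z =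
     (SUP \<theta>\<in>local_set V2 \<theta>s r.
        - (z \<theta> - z \<theta>s) + (\<theta> - \<theta>s) \<bullet> grad_within \<Theta> z \<theta>s
          - \<rho> / 2 * (norm (mat_root V2 *v (\<theta> - \<theta>s)))\<^sup>2)"

text \<open>The random set \<open>C\<^sub>\<epsilon>(r)\<close>, for an estimator \<open>\<theta>t\<close>.\<close>

definition C_set ::
  "'y measure \<Rightarrow> (real^'n) set \<Rightarrow> ('y \<Rightarrow> real^'n \<Rightarrow> real) \<Rightarrow> ('y \<Rightarrow> real^'n) \<Rightarrow> real^'n
    \<Rightarrow> real^'n^'n \<Rightarrow> real^'n^'n \<Rightarrow> real \<Rightarrow> real \<Rightarrow> real \<Rightarrow> 'y set" where
  "C_set P \<Theta> L \<theta>t \<theta>s D2 V2 \<delta> \<rho> r =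
     {y \<in> space P. \<theta>t y \<in> local_set V2 \<theta>s r \<and>
        norm (mat_root V2 *v (D_eps_inv D2 V2 (-\<delta>) (-\<rho>) *v xi_eps \<Theta> L \<theta>s D2 V2 (-\<delta>) (-\<rho>) y)) \<le> r}"

text \<open>Exponential moment condition on the gradient of the stochastic component, where \<open>w\<close> stands for
  \<open>\<omega>(r)\<close>. For \<open>w = 0\<close> the quotient is undefined and the condition means that the gradient does not
  vary over the local set; as for any identity between random variables, this is up to null sets.\<close>

definition grad_moment_cond ::
  "'y measure \<Rightarrow> (real^'n) set \<Rightarrow> ('y \<Rightarrow> real^'n \<Rightarrow> real) \<Rightarrow> real^'n \<Rightarrow> real^'n^'n
    \<Rightarrow> real \<Rightarrow> real \<Rightarrow> real \<Rightarrow> real \<Rightarrow> bool" where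
  "grad_moment_cond P \<Theta> L \<theta>s V2 g \<nu>\<^sub>0 r w \<longleftrightarrow>
     (\<forall>\<theta>\<in>local_set V2 \<theta>s r.
        if w = 0
        then AE y in P. grad_within \<Theta> (stoch_comp P L y) \<theta> = grad_within \<Theta> (stoch_comp P L y) \<theta>s
        else (\<forall>l. \<bar>l\<bar> \<le> g \<longrightarrow>
          (SUP \<gamma>\<in>UNIV - {0}. log_exp_moment P (\<lambda>y. l *
             ((\<gamma> \<bullet> (grad_within \<Theta> (stoch_comp P L y) \<theta> - grad_within \<Theta> (stoch_comp P L y) \<theta>s))
               / (w * norm (mat_root V2 *v \<gamma>)))))
          \<le> ereal (\<nu>\<^sub>0\<^sup>2 * l\<^sup>2 / 2)))"

definition local_quadratic_cond ::
  "'y measure \<Rightarrow> ('y \<Rightarrow> real^'n \<Rightarrow> real) \<Rightarrow> real^'n \<Rightarrow> real^'n^'n \<Rightarrow> real^'n^'n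
    \<Rightarrow> real \<Rightarrow> real \<Rightarrow> bool" where
  "local_quadratic_cond P L \<theta>s V2 D2 r d \<longleftrightarrow>
     (\<forall>\<theta>\<in>local_set V2 \<theta>s r. \<theta> \<noteq> \<theta>s \<longrightarrow>
        \<bar>- 2 * (mean_fun P L \<theta> - mean_fun P L \<theta>s) / (norm (mat_root D2 *v (\<theta> - \<theta>s)))\<^sup>2 - 1\<bar> \<le> d)"

end

theory Submission
  imports Defs
begin

text \<open>Write \<open>u = \<theta> - \<theta>\<^sup>*\<close> and split \<open>L(\<theta>,\<theta>\<^sup>*)\<close> into its mean and the stochastic increment
  \<open>\<zeta>(\<theta>,\<theta>\<^sup>*)\<close>. On the local set the mean equals \<open>-\<parallel>D\<^sub>0 u\<parallel>\<^sup>2/2\<close> up to the factor \<open>1 \<plusminus> \<delta>\<close>, by the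
  quadratic condition, and \<open>\<zeta>(\<theta>,\<theta>\<^sup>*)\<close> equals \<open>u \<bullet> \<nabla>\<zeta>(\<theta>\<^sup>*)\<close> up to \<open>\<rho>\<parallel>V\<^sub>0 u\<parallel>\<^sup>2/2\<close> and the error
  \<open>\<diamond>\<close>, by the definition of that error as a supremum. Hence \<open>L(\<theta>,\<theta>\<^sup>*)\<close> lies, up to \<open>\<diamond>\<close>, between
  two functions of the form \<open>u \<bullet> \<nabla>L(\<theta>\<^sup>*) - \<parallel>D u\<parallel>\<^sup>2/2\<close>, with \<open>D = D\<^sub>\<epsilon>\<close> above and
  \<open>D = D\<^sub>-\<^sub>\<epsilon>\<close> below. Such a concave function has the maximum \<open>\<parallel>\<xi>\<parallel>\<^sup>2/2\<close>, where
  \<open>\<xi> = D\<^sup>-\<^sup>1\<nabla>L(\<theta>\<^sup>*)\<close>, and takes it at \<open>u = D\<^sup>-\<^sup>1\<xi>\<close>. The upper bound follows by taking \<open>\<theta>\<close> to be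
  the estimator. For the lower bound \<open>\<theta>\<close> is the maximizer \<open>\<theta>\<^sup>* + D\<^sup>-\<^sup>1\<xi>\<close> of the lower quadratic
  function: on the random set it is in the local set, and the likelihood at the estimator is at
  least the likelihood there.

  The bounds hold for each realization of the data separately. Three supporting facts are needed. The suprema must be finite, which holds because \<open>\<zeta>\<close> is
  continuous on the compact local set. The gradients of \<open>L\<close> and \<open>\<zeta>\<close> at \<open>\<theta>\<^sup>*\<close> must agree, which
  follows from the vanishing gradient of the mean together with uniqueness of gradients at
  interior points. And symmetric positive-definite matrices must have symmetric positive-definite
  square roots; these are found as the fixed point of a contraction.\<close>

section \<open>Square roots of positive-definite matrices\<close>

lemma sym_pos_def_inner:
  assumes "sym_pos_def A"
  shows "x \<bullet> (A *v y) = (A *v x) \<bullet> y"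
  using assms by (metis dot_lmul_matrix sym_pos_def_def transpose_matrix_vector)

text \<open>A root \<open>I - Y\<close> of \<open>I - N\<close> satisfies \<open>Y = (N + Y\<^sup>2)/2\<close>. On the ball of radius \<open>\<parallel>N\<parallel> < 1\<close> the
  right-hand side is a contraction with constant \<open>\<parallel>N\<parallel>\<close>, and it preserves self-adjointness, so its
  fixed point exists and is self-adjoint.\<close>

lemma self_adjoint_quadratic_fixed_point:
  fixes N :: "'a::euclidean_space \<Rightarrow>\<^sub>L 'a"
  assumes N: "norm N < 1" and sa: "\<And>x y. x \<bullet> N y = N x \<bullet> y"
  obtains Y where "norm Y \<le> norm N" "\<And>x y. x \<bullet> blinfun_apply Y y = Y x \<bullet> y"
    "Y = (1/2) *\<^sub>R (N + (Y o\<^sub>L Y))"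
proof -
  define T where "T = (\<lambda>Y :: 'a \<Rightarrow>\<^sub>L 'a. (1/2) *\<^sub>R (N + (Y o\<^sub>L Y)))"
  define S where "S = {Y :: 'a \<Rightarrow>\<^sub>L 'a. norm Y \<le> norm N \<and> (\<forall>x y. x \<bullet> blinfun_apply Y y = Y x \<bullet> y)}"
  have "closed S"
    unfolding S_def
    by (intro closed_Collect_conj closed_Collect_all closed_Collect_le closed_Collect_eq
        continuous_intros)
  hence "uniform_space_class.complete S" by (simp add: complete_eq_closed)
  moreover have "S \<noteq> {}"
  proof -
    have "0 \<in> S" by (simp add: S_def)
    thus ?thesis by blast
  qed
  moreover have "T ` S \<subseteq> S"
  proof clarify
    fix Y assume Y: "Y \<in> S"
    have "norm (Y o\<^sub>L Y) \<le> norm Y * norm Y" by (rule norm_blinfun_compose)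
    also have "\<dots> \<le> norm N * norm N"
      using Y by (intro mult_mono) (auto simp: S_def)
    also have "\<dots> \<le> norm N" using N by (simp add: mult_left_le)
    finally have "norm (N + (Y o\<^sub>L Y)) \<le> 2 * norm N"
      using norm_triangle_ineq[of N "Y o\<^sub>L Y"] by linarith
    hence "norm (T Y) \<le> norm N" by (simp add: T_def)
    moreover have "x \<bullet> T Y y = T Y x \<bullet> y" for x y
    proof -
      have Ys: "a \<bullet> Y b = Y a \<bullet> b" for a b using Y unfolding S_def by blast
      have "x \<bullet> Y (Y y) = Y (Y x) \<bullet> y" by (simp only: Ys)
      thus ?thesis
        by (simp add: T_def blinfun.bilinear_simps inner_simps sa)
    qed
    ultimately show "T Y \<in> S" by (simp add: S_def)
  qed
  moreover have "dist (T Y) (T Z) \<le> norm N * dist Y Z" if "Y \<in> S" "Z \<in> S" for Y Z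
  proof -
    have "T Y - T Z = (1/2) *\<^sub>R ((Y o\<^sub>L (Y - Z)) + ((Y - Z) o\<^sub>L Z))"
      by (rule blinfun_eqI) (simp add: T_def blinfun.bilinear_simps algebra_simps)
    moreover have "norm ((Y o\<^sub>L (Y - Z)) + ((Y - Z) o\<^sub>L Z)) \<le> norm N * norm (Y - Z) + norm (Y - Z) * norm N"
    proof (intro order_trans[OF norm_triangle_ineq] add_mono)
      show "norm (Y o\<^sub>L (Y - Z)) \<le> norm N * norm (Y - Z)"
        using that by (intro order_trans[OF norm_blinfun_compose] mult_right_mono) (auto simp: S_def)
      show "norm ((Y - Z) o\<^sub>L Z) \<le> norm (Y - Z) * norm N"
        using that by (intro order_trans[OF norm_blinfun_compose] mult_left_mono) (auto simp: S_def)
    qed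
    ultimately show ?thesis by (simp add: dist_norm)
  qed
  ultimately obtain Y where "Y \<in> S" "T Y = Y"
    using Banach_fix[of S "norm N" T] N by (metis norm_ge_zero)
  thus thesis by (intro that[of Y]) (auto simp: S_def T_def)
qed

lemma sym_pos_def_coercive:
  fixes A :: "real^'n^'n"
  assumes A: "sym_pos_def A"
  obtains m where "m > 0" "\<And>x. x \<bullet> (A *v x) \<ge> m * (norm x)\<^sup>2"
proof -
  have "sphere (0::real^'n) 1 \<noteq> {}" by simp
  moreover have "continuous_on (sphere 0 1) (\<lambda>x. x \<bullet> (A *v x))"
    by (intro continuous_intros matrix_vector_mult_linear_continuous_on)
  ultimately obtain x0 where x0: "x0 \<in> sphere 0 1"
    "\<And>x. x \<in> sphere 0 1 \<Longrightarrow> x0 \<bullet> (A *v x0) \<le> x \<bullet> (A *v x)"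
    using continuous_attains_inf[OF compact_sphere] by blast
  have "x \<bullet> (A *v x) \<ge> (x0 \<bullet> (A *v x0)) * (norm x)\<^sup>2" for x
  proof (cases "x = 0")
    case False
    have "x0 \<bullet> (A *v x0) \<le> (x /\<^sub>R norm x) \<bullet> (A *v (x /\<^sub>R norm x))"
      using False by (intro x0) simp
    also have "\<dots> = (x \<bullet> (A *v x)) / (norm x)\<^sup>2"
      by (simp add: matrix_vector_mult_scaleR power2_eq_square field_simps)
    finally show ?thesis using False by (simp add: field_simps)
  qed simp
  moreover have "x0 \<noteq> 0" using x0(1) by auto
  hence "x0 \<bullet> (A *v x0) > 0" using A by (simp add: sym_pos_def_def)
  ultimately show thesis using that by blast
qed

text \<open>If \<open>x \<bullet> A x \<ge> m\<parallel>x\<parallel>\<^sup>2\<close> and \<open>\<parallel>A x\<parallel> \<le> K\<parallel>x\<parallel>\<close>, then \<open>N = I - A/c\<close> satisfies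
  \<open>\<parallel>N x\<parallel>\<^sup>2 \<le> (1 - 2m/c + K\<^sup>2/c\<^sup>2)\<parallel>x\<parallel>\<^sup>2\<close>, which for large \<open>c\<close> makes \<open>N\<close> small enough for the fixed
  point above; \<open>\<surd>c (I - Y)\<close> is then a root of \<open>A\<close>. It is positive definite because \<open>\<parallel>Y\<parallel> < 1\<close>.\<close>

lemma sym_pos_def_root_exists:
  fixes A :: "real^'n^'n"
  assumes A: "sym_pos_def A"
  shows "\<exists>B. sym_pos_def B \<and> B ** B = A"
proof -
  obtain m where m: "m > 0" "\<And>x. x \<bullet> (A *v x) \<ge> m * (norm x)\<^sup>2"
    using sym_pos_def_coercive[OF A] by blast
  obtain K where K: "K > 0" "\<And>x. norm (A *v x) \<le> norm x * K"
    using bounded_linear.pos_bounded[OF matrix_vector_mul_bounded_linear[of A]] by blast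
  \<comment> \<open>The summand \<open>m\<close> keeps \<open>1 - m/c\<close> nonnegative, so that its root bounds the norm.\<close>
  define c where "c = K\<^sup>2 / m + m"
  have c: "c > 0" "K\<^sup>2 \<le> m * c" "m \<le> c"
    using m(1) K(1) by (auto simp: c_def field_simps add_pos_pos)
  have bl: "bounded_linear (\<lambda>x. x - (A *v x) /\<^sub>R c)"
    by (intro bounded_linear_intros matrix_vector_mul_bounded_linear)
  define N where "N = Blinfun (\<lambda>x. x - (A *v x) /\<^sub>R c)"
  have N: "blinfun_apply N x = x - (A *v x) /\<^sub>R c" for x
    unfolding N_def using bl by (simp add: bounded_linear_Blinfun_apply)
  have "norm N \<le> sqrt (1 - m / c)"
  proof (rule norm_blinfun_bound)
    fix x
    have "(norm (A *v x))\<^sup>2 \<le> (norm x * K)\<^sup>2" by (intro power_mono K) simp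
    also have "\<dots> \<le> (m * c) * (norm x)\<^sup>2"
      using mult_right_mono[OF c(2), of "(norm x)\<^sup>2"] by (simp add: power_mult_distrib mult.commute)
    finally have "(norm (A *v x))\<^sup>2 / c\<^sup>2 \<le> m / c * (norm x)\<^sup>2"
      using c(1) by (simp add: field_simps power2_eq_square)
    moreover have "m / c * (norm x)\<^sup>2 \<le> (x \<bullet> (A *v x)) / c"
      using m(2)[of x] c(1) by (simp add: field_simps)
    moreover have "(norm (N x))\<^sup>2 = (norm x)\<^sup>2 - 2 * ((x \<bullet> (A *v x)) / c) + (norm (A *v x))\<^sup>2 / c\<^sup>2"
      unfolding N power2_norm_eq_inner using c(1)
      by (simp add: inner_simps inner_commute field_simps power2_eq_square)
    moreover have "(1 - m / c) * (norm x)\<^sup>2 = (norm x)\<^sup>2 - m / c * (norm x)\<^sup>2"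
      by (simp add: algebra_simps)
    ultimately have "(norm (N x))\<^sup>2 \<le> (1 - m / c) * (norm x)\<^sup>2" by linarith
    hence "norm (N x) \<le> sqrt ((1 - m / c) * (norm x)\<^sup>2)" by (rule real_le_rsqrt)
    thus "norm (N x) \<le> sqrt (1 - m / c) * norm x" by (simp add: real_sqrt_mult)
  qed (use c in simp)
  also have "\<dots> < 1" using m(1) c(1) by simp
  finally have N1: "norm N < 1" .
  have Nsa: "x \<bullet> N y = N x \<bullet> y" for x y
    unfolding N by (simp add: inner_simps sym_pos_def_inner[OF A])
  obtain Y where Y: "norm Y \<le> norm N" "\<And>x y. x \<bullet> blinfun_apply Y y = Y x \<bullet> y"
    "Y = (1/2) *\<^sub>R (N + (Y o\<^sub>L Y))"
    using self_adjoint_quadratic_fixed_point[OF N1 Nsa] by blast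
  define f where "f = (\<lambda>x. sqrt c *\<^sub>R (x - blinfun_apply Y x))"
  have lf: "linear f"
    unfolding f_def by (intro bounded_linear.linear bounded_linear_intros)
  have Bf: "matrix f *v x = f x" for x
    using lf by (simp add: matrix_works linear_matrix_vector_mul_eq)
  have ff: "f (f x) = A *v x" for x
  proof -
    have "2 *\<^sub>R blinfun_apply Y x = N x + Y (Y x)"
      using arg_cong[OF Y(3), of "\<lambda>Z. 2 *\<^sub>R blinfun_apply Z x"]
      by (simp add: blinfun.bilinear_simps)
    hence "x - 2 *\<^sub>R blinfun_apply Y x + Y (Y x) = (A *v x) /\<^sub>R c" by (simp add: N algebra_simps)
    moreover have "f (f x) = c *\<^sub>R (x - 2 *\<^sub>R blinfun_apply Y x + Y (Y x))"
      using c(1) by (simp add: f_def blinfun.bilinear_simps algebra_simps scaleR_2)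
    ultimately show ?thesis using c(1) by simp
  qed
  have "matrix f ** matrix f = A"
    by (simp add: matrix_eq matrix_vector_mul_assoc[symmetric] Bf ff)
  moreover have "transpose (matrix f) = matrix f"
  proof -
    have "transpose (matrix f) *v x = matrix f *v x" for x
    proof (rule vector_eq_ldot[THEN iffD1], rule allI)
      fix y
      have "y \<bullet> (transpose (matrix f) *v x) = (matrix f *v y) \<bullet> x"
        by (simp add: inner_commute flip: dot_lmul_matrix)
      also have "\<dots> = y \<bullet> (matrix f *v x)"
        unfolding Bf by (simp add: f_def inner_simps Y(2))
      finally show "y \<bullet> (transpose (matrix f) *v x) = y \<bullet> (matrix f *v x)" .
    qed
    thus ?thesis unfolding matrix_eq by blast
  qed
  moreover have "x \<bullet> (matrix f *v x) > 0" if "x \<noteq> 0" for x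
  proof -
    have "x \<bullet> Y x \<le> norm x * norm (Y x)" by (rule norm_cauchy_schwarz)
    also have "\<dots> \<le> norm x * (norm Y * norm x)"
      by (intro mult_left_mono norm_blinfun) simp
    also have "\<dots> < norm x * (1 * norm x)"
      using that Y(1) N1 by (intro mult_strict_left_mono mult_strict_right_mono) auto
    finally have "x \<bullet> Y x < x \<bullet> x" by (simp add: dot_square_norm power2_eq_square)
    thus ?thesis unfolding Bf using c(1) by (simp add: f_def inner_simps)
  qed
  ultimately show ?thesis unfolding sym_pos_def_def by blast
qed

lemma
  assumes "sym_pos_def A"
  shows sym_pos_def_mat_root: "sym_pos_def (mat_root A)"
    and mat_root_square: "mat_root A ** mat_root A = A"
  using someI_ex[OF sym_pos_def_root_exists[OF assms]] by (auto simp: mat_root_def)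

lemma norm_mat_root:
  assumes "sym_pos_def A"
  shows "(norm (mat_root A *v x))\<^sup>2 = x \<bullet> (A *v x)"
  by (metis assms mat_root_square matrix_vector_mul_assoc power2_norm_eq_inner
      sym_pos_def_inner sym_pos_def_mat_root)

lemma sym_pos_def_inverse:
  fixes B :: "real^'n^'n"
  assumes "sym_pos_def B"
  shows "matrix_inv B *v (B *v x) = x" and "B *v (matrix_inv B *v x) = x"
proof -
  have "\<forall>x. B *v x = 0 \<longrightarrow> x = 0"
    using assms by (metis inner_zero_right order_less_irrefl sym_pos_def_def)
  hence "invertible B"
    by (simp add: invertible_left_inverse matrix_left_invertible_ker)
  hence "B ** matrix_inv B = mat 1 \<and> matrix_inv B ** B = mat 1"
    unfolding invertible_def matrix_inv_def by (rule someI_ex)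
  thus "matrix_inv B *v (B *v x) = x" "B *v (matrix_inv B *v x) = x"
    by (simp_all add: matrix_vector_mul_assoc)
qed

section \<open>The quadratic approximation\<close>

text \<open>Completing the square: with \<open>B\<close> the root of \<open>A\<close>, the difference of the two sides is
  \<open>\<parallel>B u - B\<^sup>-\<^sup>1 v\<parallel>\<^sup>2/2\<close>.\<close>

lemma quadratic_upper_bound:
  fixes A :: "real^'n^'n"
  assumes "sym_pos_def A"
  shows "u \<bullet> v - (u \<bullet> (A *v u)) / 2 \<le> (norm (matrix_inv (mat_root A) *v v))\<^sup>2 / 2"
proof -
  let ?B = "mat_root A" and ?\<xi> = "matrix_inv (mat_root A) *v v"
  have "u \<bullet> v = (?B *v u) \<bullet> ?\<xi>"
    using sym_pos_def_mat_root[OF assms] by (metis sym_pos_def_inner sym_pos_def_inverse(2))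
  moreover have "0 \<le> (norm (?B *v u - ?\<xi>))\<^sup>2" by simp
  ultimately show ?thesis
    by (simp add: norm_mat_root[OF assms, symmetric] power2_norm_eq_inner inner_simps inner_commute)
qed

lemma quadratic_maximum:
  fixes A :: "real^'n^'n" and v :: "real^'n"
  assumes "sym_pos_def A"
  defines "\<xi> \<equiv> matrix_inv (mat_root A) *v v"
  defines "u \<equiv> matrix_inv (mat_root A) *v \<xi>"
  shows "u \<bullet> v - (u \<bullet> (A *v u)) / 2 = (norm \<xi>)\<^sup>2 / 2"
proof -
  note B = sym_pos_def_mat_root[OF assms(1)]
  have Bu: "mat_root A *v u = \<xi>"
    unfolding u_def by (rule sym_pos_def_inverse[OF B])
  have "u \<bullet> v = (mat_root A *v u) \<bullet> \<xi>"
    unfolding \<xi>_def using B by (metis sym_pos_def_inner sym_pos_def_inverse(2))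
  thus ?thesis
    by (simp add: norm_mat_root[OF assms(1), symmetric] Bu power2_norm_eq_inner)
qed

lemma inner_D_eps_sq:
  assumes "sym_pos_def D2" "sym_pos_def V2"
  shows "u \<bullet> (D_eps_sq D2 V2 \<delta> \<rho> *v u)
    = (1 - \<delta>) * (norm (mat_root D2 *v u))\<^sup>2 - \<rho> * (norm (mat_root V2 *v u))\<^sup>2"
  by (simp add: D_eps_sq_def norm_mat_root assms matrix_vector_mult_diff_rdistrib
      scaleR_matrix_vector_assoc[symmetric] inner_simps)

lemma sym_pos_def_D_eps_sq:
  assumes D: "sym_pos_def D2" and V: "sym_pos_def V2" and "\<delta> < 1" "\<rho> \<le> 0"
  shows "sym_pos_def (D_eps_sq D2 V2 \<delta> \<rho>)"
  unfolding sym_pos_def_def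
proof (intro conjI allI impI)
  show "transpose (D_eps_sq D2 V2 \<delta> \<rho>) = D_eps_sq D2 V2 \<delta> \<rho>"
    using D V by (simp add: sym_pos_def_def D_eps_sq_def transpose_def vec_eq_iff)
next
  fix u :: "real^'a" assume "u \<noteq> 0"
  hence "u \<bullet> (D2 *v u) > 0" "u \<bullet> (V2 *v u) \<ge> 0"
    using D V by (auto simp: sym_pos_def_def intro: less_imp_le)
  hence "(1 - \<delta>) * (u \<bullet> (D2 *v u)) > 0" "\<rho> * (u \<bullet> (V2 *v u)) \<le> 0"
    using \<open>\<delta> < 1\<close> \<open>\<rho> \<le> 0\<close> by (simp_all add: mult_nonpos_nonneg)
  thus "u \<bullet> (D_eps_sq D2 V2 \<delta> \<rho> *v u) > 0"
    unfolding inner_D_eps_sq[OF D V] norm_mat_root[OF D] norm_mat_root[OF V] by linarith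
qed

text \<open>The quotient form of the condition says nothing at the centre, but there both sides vanish.\<close>

lemma local_quadratic_bound:
  assumes c: "local_quadratic_cond P L \<theta>s V2 D2 r d" and D: "sym_pos_def D2"
    and \<theta>: "\<theta> \<in> local_set V2 \<theta>s r" and "d \<le> \<delta>"
  shows "\<bar>2 * (mean_fun P L \<theta> - mean_fun P L \<theta>s) + (norm (mat_root D2 *v (\<theta> - \<theta>s)))\<^sup>2\<bar>
    \<le> \<delta> * (norm (mat_root D2 *v (\<theta> - \<theta>s)))\<^sup>2"
proof (cases "\<theta> = \<theta>s")
  case False
  let ?q = "(norm (mat_root D2 *v (\<theta> - \<theta>s)))\<^sup>2" and ?m = "mean_fun P L \<theta> - mean_fun P L \<theta>s"
  have q: "?q > 0" using D False by (simp add: norm_mat_root sym_pos_def_def)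
  have "\<bar>- 2 * ?m / ?q - 1\<bar> \<le> \<delta>"
    using c \<theta> False \<open>d \<le> \<delta>\<close> unfolding local_quadratic_cond_def by fastforce
  moreover have "2 * ?m + ?q = - ((- 2 * ?m / ?q - 1) * ?q)"
    using q by (simp add: field_simps)
  hence "\<bar>2 * ?m + ?q\<bar> = \<bar>- 2 * ?m / ?q - 1\<bar> * ?q"
    using q by (simp only: abs_minus_cancel abs_mult abs_of_pos)
  ultimately show ?thesis using q by (simp add: mult_right_mono)
qed simp

section \<open>The local set and gradients at its centre\<close>

lemma compact_local_set:
  assumes V: "sym_pos_def V2"
  shows "compact (local_set V2 \<theta>s r)"
proof -
  note B = sym_pos_def_inverse[OF sym_pos_def_mat_root[OF V]]
  have "local_set V2 \<theta>s r = (\<lambda>v. \<theta>s + matrix_inv (mat_root V2) *v v) ` cball 0 r"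
  proof (intro equalityI subsetI)
    fix \<theta> assume "\<theta> \<in> local_set V2 \<theta>s r"
    thus "\<theta> \<in> (\<lambda>v. \<theta>s + matrix_inv (mat_root V2) *v v) ` cball 0 r"
      by (intro image_eqI[of _ _ "mat_root V2 *v (\<theta> - \<theta>s)"]) (simp_all add: B local_set_def)
  qed (auto simp: local_set_def B)
  thus ?thesis
    by (auto intro!: compact_continuous_image continuous_intros
        matrix_vector_mult_linear_continuous_on)
qed

lemma centre_in_interior_local_set:
  assumes "r > 0"
  shows "\<theta>s \<in> interior (local_set V2 \<theta>s r)"
proof (rule interiorI)
  show "open {\<theta>. norm (mat_root V2 *v (\<theta> - \<theta>s)) < r}"
    by (intro open_Collect_less continuous_intros
        continuous_on_compose2[OF matrix_vector_mult_linear_continuous_on[of UNIV]]) auto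
qed (use assms in \<open>auto simp: local_set_def\<close>)

lemma grad_within_has_derivative:
  fixes f :: "real^'n \<Rightarrow> real"
  assumes "f differentiable (at x within S)"
  shows "(f has_derivative (\<lambda>h. grad_within S f x \<bullet> h)) (at x within S)"
proof -
  obtain f' where f': "(f has_derivative f') (at x within S)"
    using assms by (auto simp: differentiable_def)
  have "f' h = adjoint f' 1 \<bullet> h" for h
    using adjoint_works[OF has_derivative_linear[OF f'], of h 1] by (simp add: inner_commute)
  hence "f' = (\<lambda>h. adjoint f' 1 \<bullet> h)" by blast
  hence "\<exists>g. (f has_derivative (\<lambda>h. g \<bullet> h)) (at x within S)" using f' by metis
  thus ?thesis unfolding grad_within_def by (rule someI_ex)
qed

lemma grad_within_eqI:
  fixes f :: "real^'n \<Rightarrow> real"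
  assumes f: "(f has_derivative (\<lambda>h. g \<bullet> h)) (at x within S)" and x: "x \<in> interior S"
  shows "grad_within S f x = g"
proof -
  have "(f has_derivative (\<lambda>h. grad_within S f x \<bullet> h)) (at x within S)"
    using f by (intro grad_within_has_derivative) (auto simp: differentiable_def)
  with f have "(\<lambda>h. grad_within S f x \<bullet> h) = (\<lambda>h. g \<bullet> h)"
    unfolding at_within_interior[OF x] by (intro has_derivative_unique)
  thus ?thesis by (metis vector_eq_rdot)
qed

lemma grad_within_stoch_comp:
  assumes x: "x \<in> interior \<Theta>"
    and z: "stoch_comp P L y differentiable (at x within \<Theta>)"
    and m: "mean_fun P L differentiable (at x within \<Theta>)" "grad_within \<Theta> (mean_fun P L) x = 0"
  shows "grad_within \<Theta> (L y) x = grad_within \<Theta> (stoch_comp P L y) x"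
proof (rule grad_within_eqI[OF _ x])
  have "((\<lambda>\<theta>. stoch_comp P L y \<theta> + mean_fun P L \<theta>) has_derivative
      (\<lambda>h. grad_within \<Theta> (stoch_comp P L y) x \<bullet> h + grad_within \<Theta> (mean_fun P L) x \<bullet> h))
      (at x within \<Theta>)"
    by (intro has_derivative_add grad_within_has_derivative z m)
  thus "(L y has_derivative (\<lambda>h. grad_within \<Theta> (stoch_comp P L y) x \<bullet> h)) (at x within \<Theta>)"
    by (simp add: stoch_comp_def m(2))
qed

section \<open>Bracketing of the likelihood\<close>

text \<open>A supremum of reals bounds its terms only if it is finite; continuity on the compact local set
  provides this for both error terms.\<close>

lemma
  fixes z :: "real^'n \<Rightarrow> real"
  assumes V: "sym_pos_def V2" and z: "continuous_on (local_set V2 \<theta>s r) z"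
    and \<theta>: "\<theta> \<in> local_set V2 \<theta>s r"
  shows diamond_upper_ge: "(z \<theta> - z \<theta>s) - (\<theta> - \<theta>s) \<bullet> grad_within \<Theta> z \<theta>s
      - \<rho> / 2 * (norm (mat_root V2 *v (\<theta> - \<theta>s)))\<^sup>2 \<le> diamond_upper \<Theta> V2 \<theta>s \<rho> r z"
    and diamond_lower_ge: "- (z \<theta> - z \<theta>s) + (\<theta> - \<theta>s) \<bullet> grad_within \<Theta> z \<theta>s
      - \<rho> / 2 * (norm (mat_root V2 *v (\<theta> - \<theta>s)))\<^sup>2 \<le> diamond_lower \<Theta> V2 \<theta>s \<rho> r z"
proof -
  have bdd: "bdd_above (f ` local_set V2 \<theta>s r)"
    if "continuous_on (local_set V2 \<theta>s r) f" for f :: "real^'n \<Rightarrow> real"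
    using compact_continuous_image[OF that compact_local_set[OF V]]
    by (intro bounded_imp_bdd_above compact_imp_bounded)
  have [continuous_intros]: "continuous_on T (\<lambda>\<theta>. mat_root V2 *v (\<theta> - \<theta>s))" for T
    by (rule continuous_on_compose2[OF matrix_vector_mult_linear_continuous_on[of UNIV]])
      (auto intro!: continuous_intros)
  show "(z \<theta> - z \<theta>s) - (\<theta> - \<theta>s) \<bullet> grad_within \<Theta> z \<theta>s
      - \<rho> / 2 * (norm (mat_root V2 *v (\<theta> - \<theta>s)))\<^sup>2 \<le> diamond_upper \<Theta> V2 \<theta>s \<rho> r z"
    unfolding diamond_upper_def
    by (rule cSUP_upper[OF \<theta>], rule bdd) (intro continuous_intros z)
  show "- (z \<theta> - z \<theta>s) + (\<theta> - \<theta>s) \<bullet> grad_within \<Theta> z \<theta>s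
      - \<rho> / 2 * (norm (mat_root V2 *v (\<theta> - \<theta>s)))\<^sup>2 \<le> diamond_lower \<Theta> V2 \<theta>s \<rho> r z"
    unfolding diamond_lower_def
    by (rule cSUP_upper[OF \<theta>], rule bdd) (intro continuous_intros z)
qed

text \<open>Adding the mean, estimated by the quadratic condition, to the stochastic increment, estimated by
  the error terms, makes \<open>\<delta>\<parallel>D\<^sub>0 u\<parallel>\<^sup>2/2\<close> and \<open>\<rho>\<parallel>V\<^sub>0 u\<parallel>\<^sup>2/2\<close> enter with the same sign. This is why
  \<open>D\<^sub>\<epsilon>\<^sup>2\<close> and \<open>D\<^sub>-\<^sub>\<epsilon>\<^sup>2\<close> are the matrices that appear.\<close>

lemma
  fixes L :: "'y \<Rightarrow> real^'n \<Rightarrow> real" and \<Theta> :: "(real^'n) set"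
  assumes V: "sym_pos_def V2" and D: "sym_pos_def D2"
    and cont: "continuous_on (local_set V2 \<theta>s r) (stoch_comp P L y)"
    and quad: "local_quadratic_cond P L \<theta>s V2 D2 r d" "d \<le> \<delta>"
    and \<theta>: "\<theta> \<in> local_set V2 \<theta>s r"
  defines "G \<equiv> grad_within \<Theta> (stoch_comp P L y) \<theta>s"
  shows likelihood_le_quadratic: "L y \<theta> - L y \<theta>s
      \<le> (\<theta> - \<theta>s) \<bullet> G - ((\<theta> - \<theta>s) \<bullet> (D_eps_sq D2 V2 \<delta> \<rho> *v (\<theta> - \<theta>s))) / 2
        + diamond_upper \<Theta> V2 \<theta>s \<rho> r (stoch_comp P L y)"
    and likelihood_ge_quadratic: "L y \<theta> - L y \<theta>s
      \<ge> (\<theta> - \<theta>s) \<bullet> G - ((\<theta> - \<theta>s) \<bullet> (D_eps_sq D2 V2 (-\<delta>) (-\<rho>) *v (\<theta> - \<theta>s))) / 2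
        - diamond_lower \<Theta> V2 \<theta>s \<rho> r (stoch_comp P L y)"
proof -
  let ?z = "stoch_comp P L y" and ?m = "mean_fun P L" and ?u = "\<theta> - \<theta>s"
  define q where "q = (norm (mat_root D2 *v ?u))\<^sup>2"
  define w where "w = (norm (mat_root V2 *v ?u))\<^sup>2"
  have split: "L y \<theta> - L y \<theta>s = (?m \<theta> - ?m \<theta>s) + (?z \<theta> - ?z \<theta>s)"
    by (simp add: stoch_comp_def)
  have "\<bar>2 * (?m \<theta> - ?m \<theta>s) + q\<bar> \<le> \<delta> * q"
    using local_quadratic_bound[OF quad(1) D \<theta> quad(2)] by (simp add: q_def)
  hence mean: "2 * (?m \<theta> - ?m \<theta>s) \<le> \<delta> * q - q" "2 * (?m \<theta> - ?m \<theta>s) \<ge> - (\<delta> * q) - q"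
    by linarith+
  have upper: "(?z \<theta> - ?z \<theta>s) - ?u \<bullet> G - \<rho> * w / 2 \<le> diamond_upper \<Theta> V2 \<theta>s \<rho> r ?z"
    using diamond_upper_ge[OF V cont \<theta>, where \<Theta> = \<Theta> and \<rho> = \<rho>] by (simp add: G_def w_def)
  have lower: "- (?z \<theta> - ?z \<theta>s) + ?u \<bullet> G - \<rho> * w / 2 \<le> diamond_lower \<Theta> V2 \<theta>s \<rho> r ?z"
    using diamond_lower_ge[OF V cont \<theta>, where \<Theta> = \<Theta> and \<rho> = \<rho>] by (simp add: G_def w_def)
  have D_upper: "?u \<bullet> (D_eps_sq D2 V2 \<delta> \<rho> *v ?u) = q - \<delta> * q - \<rho> * w"
    and D_lower: "?u \<bullet> (D_eps_sq D2 V2 (-\<delta>) (-\<rho>) *v ?u) = q + \<delta> * q + \<rho> * w"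
    unfolding inner_D_eps_sq[OF D V] q_def[symmetric] w_def[symmetric]
    by (simp_all add: algebra_simps)
  show "L y \<theta> - L y \<theta>s \<le> ?u \<bullet> G - (?u \<bullet> (D_eps_sq D2 V2 \<delta> \<rho> *v ?u)) / 2
        + diamond_upper \<Theta> V2 \<theta>s \<rho> r ?z"
    unfolding split D_upper using mean upper by (simp add: field_simps)
  show "L y \<theta> - L y \<theta>s \<ge> ?u \<bullet> G - (?u \<bullet> (D_eps_sq D2 V2 (-\<delta>) (-\<rho>) *v ?u)) / 2
        - diamond_lower \<Theta> V2 \<theta>s \<rho> r ?z"
    unfolding split D_lower using mean lower by (simp add: field_simps)
qed

theorem corollary3p3:
  fixes P :: "'y measure"
    and \<Theta> :: "(real^'p) set"
    and L :: "'y \<Rightarrow> real^'p \<Rightarrow> real"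
    and \<theta>t :: "'y \<Rightarrow> real^'p"
    and \<theta>s :: "real^'p"
    and V2 D2 :: "real^'p^'p"
    and g \<nu>\<^sub>0 r\<^sub>0 r \<delta> \<rho> :: real
    and \<omega> \<delta>\<^sub>r :: "real \<Rightarrow> real"
  assumes "prob_space P"
    and "\<forall>\<theta>\<in>\<Theta>. integrable P (\<lambda>y. L y \<theta>)"
    and "\<forall>y\<in>space P. is_arg_max (L y) (\<lambda>\<theta>. \<theta> \<in> \<Theta>) (\<theta>t y)"
    and "is_arg_max (mean_fun P L) (\<lambda>\<theta>. \<theta> \<in> \<Theta>) \<theta>s"
    and "mean_fun P L differentiable (at \<theta>s within \<Theta>)"
    and "grad_within \<Theta> (mean_fun P L) \<theta>s = 0"
    and "\<forall>y\<in>space P. \<forall>\<theta>\<in>\<Theta>. stoch_comp P L y differentiable (at \<theta> within \<Theta>)"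
    and "sym_pos_def V2"
    and "g > 0" and "\<nu>\<^sub>0 \<ge> 1" and "r\<^sub>0 > 0"
    and "local_set V2 \<theta>s r\<^sub>0 \<subseteq> \<Theta>"
    and "r \<le> r\<^sub>0"
    and "0 \<le> \<omega> r" and "\<omega> r \<le> 1/2"
    and "grad_moment_cond P \<Theta> L \<theta>s V2 g \<nu>\<^sub>0 r (\<omega> r)"
    and "sym_pos_def D2"
    and "0 \<le> \<delta>\<^sub>r r" and "\<delta>\<^sub>r r \<le> 1/2"
    and "local_quadratic_cond P L \<theta>s V2 D2 r (\<delta>\<^sub>r r)"
    and "\<rho> \<ge> 3 * \<nu>\<^sub>0 * \<omega> r"
    and "\<delta> \<ge> \<delta>\<^sub>r r"
    and "sym_pos_def (D_eps_sq D2 V2 \<delta> \<rho>)"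
  shows "\<forall>y \<in> C_set P \<Theta> L \<theta>t \<theta>s D2 V2 \<delta> \<rho> r.
      (norm (xi_eps \<Theta> L \<theta>s D2 V2 (-\<delta>) (-\<rho>) y))\<^sup>2 / 2
          - diamond_lower \<Theta> V2 \<theta>s \<rho> r (stoch_comp P L y)
        \<le> L y (\<theta>t y) - L y \<theta>s
    \<and> L y (\<theta>t y) - L y \<theta>s
        \<le> (norm (xi_eps \<Theta> L \<theta>s D2 V2 \<delta> \<rho> y))\<^sup>2 / 2
          + diamond_upper \<Theta> V2 \<theta>s \<rho> r (stoch_comp P L y)"
proof
  fix y assume y: "y \<in> C_set P \<Theta> L \<theta>t \<theta>s D2 V2 \<delta> \<rho> r"
  note V = \<open>sym_pos_def V2\<close> and D = \<open>sym_pos_def D2\<close>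
    and \<theta>s_max = \<open>is_arg_max (mean_fun P L) (\<lambda>\<theta>. \<theta> \<in> \<Theta>) \<theta>s\<close>
    and quad = \<open>local_quadratic_cond P L \<theta>s V2 D2 r (\<delta>\<^sub>r r)\<close> \<open>\<delta> \<ge> \<delta>\<^sub>r r\<close>
  define G where "G = grad_within \<Theta> (stoch_comp P L y) \<theta>s"
  let ?\<xi>l = "xi_eps \<Theta> L \<theta>s D2 V2 (-\<delta>) (-\<rho>) y"
  have ysp: "y \<in> space P" and \<theta>t: "\<theta>t y \<in> local_set V2 \<theta>s r"
    and step: "norm (mat_root V2 *v (D_eps_inv D2 V2 (-\<delta>) (-\<rho>) *v ?\<xi>l)) \<le> r"
    using y by (auto simp: C_set_def)
  have sub: "local_set V2 \<theta>s r \<subseteq> \<Theta>"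
    using \<open>local_set V2 \<theta>s r\<^sub>0 \<subseteq> \<Theta>\<close> \<open>r \<le> r\<^sub>0\<close> by (auto simp: local_set_def)
  have zdiff: "\<forall>\<theta>\<in>\<Theta>. stoch_comp P L y differentiable (at \<theta> within \<Theta>)"
    using assms(7) ysp by blast
  have cont: "continuous_on (local_set V2 \<theta>s r) (stoch_comp P L y)"
    using zdiff by (intro continuous_on_subset[OF _ sub])
      (auto simp: continuous_on_eq_continuous_within intro: differentiable_imp_continuous_within)
  have "\<theta>s \<in> interior \<Theta>"
    using centre_in_interior_local_set[OF \<open>r\<^sub>0 > 0\<close>] interior_mono[OF \<open>local_set V2 \<theta>s r\<^sub>0 \<subseteq> \<Theta>\<close>]
    by blast
  moreover have "\<theta>s \<in> \<Theta>" using \<theta>s_max by (simp add: is_arg_max_def)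
  ultimately have grad: "grad_within \<Theta> (L y) \<theta>s = G"
    unfolding G_def using zdiff assms(5,6) by (intro grad_within_stoch_comp) auto
  have xi: "xi_eps \<Theta> L \<theta>s D2 V2 a b y = matrix_inv (mat_root (D_eps_sq D2 V2 a b)) *v G" for a b
    by (simp add: xi_eps_def D_eps_inv_def grad)
  have upper: "L y (\<theta>t y) - L y \<theta>s \<le> (norm (xi_eps \<Theta> L \<theta>s D2 V2 \<delta> \<rho> y))\<^sup>2 / 2
      + diamond_upper \<Theta> V2 \<theta>s \<rho> r (stoch_comp P L y)"
    unfolding xi
    using likelihood_le_quadratic[OF V D cont quad \<theta>t, where \<Theta> = \<Theta> and \<rho> = \<rho>]
      quadratic_upper_bound[OF \<open>sym_pos_def (D_eps_sq D2 V2 \<delta> \<rho>)\<close>, of "\<theta>t y - \<theta>s" G]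
    unfolding G_def by linarith
  have "0 \<le> 3 * \<nu>\<^sub>0 * \<omega> r" using \<open>\<nu>\<^sub>0 \<ge> 1\<close> \<open>0 \<le> \<omega> r\<close> by simp
  hence "\<rho> \<ge> 0" using \<open>\<rho> \<ge> 3 * \<nu>\<^sub>0 * \<omega> r\<close> by linarith
  moreover have "\<delta> \<ge> 0" using \<open>0 \<le> \<delta>\<^sub>r r\<close> quad(2) by linarith
  ultimately have Dl: "sym_pos_def (D_eps_sq D2 V2 (-\<delta>) (-\<rho>))"
    by (intro sym_pos_def_D_eps_sq D V) auto
  \<comment> \<open>The maximizer of the quadratic lower bound.\<close>
  define \<theta>l where "\<theta>l = \<theta>s + D_eps_inv D2 V2 (-\<delta>) (-\<rho>) *v ?\<xi>l"
  have \<theta>l: "\<theta>l \<in> local_set V2 \<theta>s r" using step by (simp add: \<theta>l_def local_set_def)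
  have "\<theta>l - \<theta>s = matrix_inv (mat_root (D_eps_sq D2 V2 (-\<delta>) (-\<rho>))) *v
      (matrix_inv (mat_root (D_eps_sq D2 V2 (-\<delta>) (-\<rho>))) *v G)"
    by (simp add: \<theta>l_def xi D_eps_inv_def)
  hence "(\<theta>l - \<theta>s) \<bullet> G - ((\<theta>l - \<theta>s) \<bullet> (D_eps_sq D2 V2 (-\<delta>) (-\<rho>) *v (\<theta>l - \<theta>s))) / 2
      = (norm ?\<xi>l)\<^sup>2 / 2"
    unfolding xi using quadratic_maximum[OF Dl, of G] by simp
  hence "(norm ?\<xi>l)\<^sup>2 / 2 - diamond_lower \<Theta> V2 \<theta>s \<rho> r (stoch_comp P L y) \<le> L y \<theta>l - L y \<theta>s"
    using likelihood_ge_quadratic[OF V D cont quad \<theta>l, where \<Theta> = \<Theta> and \<rho> = \<rho>]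
    unfolding G_def by linarith
  also have "\<dots> \<le> L y (\<theta>t y) - L y \<theta>s"
    using assms(3) ysp \<theta>l sub by (fastforce simp: is_arg_max_def not_less)
  finally show "(norm ?\<xi>l)\<^sup>2 / 2 - diamond_lower \<Theta> V2 \<theta>s \<rho> r (stoch_comp P L y)
        \<le> L y (\<theta>t y) - L y \<theta>s
    \<and> L y (\<theta>t y) - L y \<theta>s
        \<le> (norm (xi_eps \<Theta> L \<theta>s D2 V2 \<delta> \<rho> y))\<^sup>2 / 2
          + diamond_upper \<Theta> V2 \<theta>s \<rho> r (stoch_comp P L y)"
    using upper by blast
qed

end
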